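(* Let $G$ be a connected block graph, let $k\ge 0$ be an integer, and let $H$ be its block--cutpoint tree with vertex set $A\cup\mathcal{B}'$. For $Z\subseteq V(H)$ define $X_Z=\Big(\bigcup_{b\in Z\cap \mathcal{B}'} (V(B_b)\setminus A)\Big)\cup (Z\cap A)$. Then $$\mu_k(G)=\max\{\,|X_Z| : Z\subseteq V(H)\text{ is $k$-admissible}\,\}.$$
   Context: A block of $G$ is a maximal 2-connected subgraph (maximal connected subgraph without a cut vertex); $G$ is a block graph if every block is a clique. $A$ denotes the set of articulation (cut) vertices of $G$. The block--cutpoint tree $H$ is the bipartite graph with vertex set $A\cup\mathcal{B}'$, where $\mathcal{B}'$ has one vertex $b$ for each block $B_b$ of $G$, and $vb\in E(H)$ iff $v\in A\cap V(B_b)$; it is a tree when $G$ is connected. A subset $Z\subseteq V(H)$ is $k$-admissible if for every pair of distinct $\alpha,\beta\in Z$, $\bigl|(V(P_H(\alpha,\beta))\setminus\{\alpha,\beta\})\cap(Z\cap A)\bigr|\le k$, where $P_H(\alpha,\beta)$ is the unique $(\alpha,\beta)$-path in $H$. For $X\subseteq V(G)$, vertices $u,v$ are $(X,k)$-visible if some shortest $(u,v)$-path in $G$ has at most $k$ internal vertices in $X$; $X$ is a mutual $k$-visible set if every pair of distinct vertices of $X$ is $(X,k)$-visible; $\mu_k(G)$ is the maximum cardinality of a mutual $k$-visible set. *)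

theory Defs
  imports "Graph_Theory.Graph_Theory"
begin

text \<open>
  Finite simple graphs are the symmetric digraphs of the locale \<^locale>\<open>graph\<close>: finite, without
  loops and parallel arcs, each edge being a pair of opposite arcs. Note that \<^const>\<open>connected\<close>
  excludes the graph without vertices.
\<close>

text \<open>
  The strongly connected components of a symmetric digraph are its connected components. Counting
  them, rather than asking for \<open>G - v\<close> to be connected, gives the right answer for the one-vertex
  graph, which has no cut vertex and therefore is its own block.
\<close>
definition cut_verts :: "('a, 'b) pre_digraph \<Rightarrow> 'a set" where
  "cut_verts G = {v \<in> verts G.
     card (pre_digraph.sccs G) < card (pre_digraph.sccs (pre_digraph.del_vert G v))}"

text \<open>
  The conjunct \<^term>\<open>graph B\<close> is needed because \<^const>\<open>subgraph\<close> alone would admit subdigraphs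
  that contain only one of two opposite arcs.
\<close>
definition blocks :: "('a, 'b) pre_digraph \<Rightarrow> ('a, 'b) pre_digraph set" where
  "blocks G = {B. pre_digraph.max_subgraph G
     (\<lambda>B. graph B \<and> connected B \<and> cut_verts B = {}) B}"

definition block_graph :: "('a, 'b) pre_digraph \<Rightarrow> bool" where
  "block_graph G \<longleftrightarrow> (\<forall>B \<in> blocks G. complete_digraph (card (verts B)) B)"

definition block_cut_tree ::
  "('a, 'b) pre_digraph \<Rightarrow> ('a + ('a, 'b) pre_digraph) pair_pre_digraph" where
  "block_cut_tree G = \<lparr>
     pverts = Inl ` cut_verts G \<union> Inr ` blocks G,
     parcs = {(Inl v, Inr B) | v B. B \<in> blocks G \<and> v \<in> cut_verts G \<inter> verts B} \<union>
             {(Inr B, Inl v) | v B. B \<in> blocks G \<and> v \<in> cut_verts G \<inter> verts B} \<rparr>"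

text \<open>The vertex set of the unique path between two vertices of a tree.\<close>
definition tree_path_verts :: "'v pair_pre_digraph \<Rightarrow> 'v \<Rightarrow> 'v \<Rightarrow> 'v set" where
  "tree_path_verts H \<alpha> \<beta> =
     set (pre_digraph.awalk_verts (with_proj H) \<alpha>
       (THE p. pre_digraph.apath (with_proj H) \<alpha> p \<beta>))"

definition k_admissible ::
  "('a, 'b) pre_digraph \<Rightarrow> nat \<Rightarrow> ('a + ('a, 'b) pre_digraph) set \<Rightarrow> bool" where
  "k_admissible G k Z \<longleftrightarrow>
     (\<forall>\<alpha> \<in> Z. \<forall>\<beta> \<in> Z. \<alpha> \<noteq> \<beta> \<longrightarrow>
        card ((tree_path_verts (block_cut_tree G) \<alpha> \<beta> - {\<alpha>, \<beta>}) \<inter> (Z \<inter> Inl ` cut_verts G)) \<le> k)"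

definition tree_to_verts ::
  "('a, 'b) pre_digraph \<Rightarrow> ('a + ('a, 'b) pre_digraph) set \<Rightarrow> 'a set" where
  "tree_to_verts G Z =
     (\<Union>B \<in> {B \<in> blocks G. Inr B \<in> Z}. verts B - cut_verts G) \<union> {v \<in> cut_verts G. Inl v \<in> Z}"

definition shortest_path ::
  "('a, 'b) pre_digraph \<Rightarrow> 'a \<Rightarrow> 'b awalk \<Rightarrow> 'a \<Rightarrow> bool" where
  "shortest_path G u p v \<longleftrightarrow> pre_digraph.apath G u p v \<and>
     (\<forall>q. pre_digraph.apath G u q v \<longrightarrow> length p \<le> length q)"

definition k_visible ::
  "('a, 'b) pre_digraph \<Rightarrow> 'a set \<Rightarrow> nat \<Rightarrow> 'a \<Rightarrow> 'a \<Rightarrow> bool" where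
  "k_visible G X k u v \<longleftrightarrow>
     (\<exists>p. shortest_path G u p v \<and> card (set (pre_digraph.inner_verts G p) \<inter> X) \<le> k)"

definition mutual_k_visible :: "('a, 'b) pre_digraph \<Rightarrow> nat \<Rightarrow> 'a set \<Rightarrow> bool" where
  "mutual_k_visible G k X \<longleftrightarrow> (\<forall>u \<in> X. \<forall>v \<in> X. u \<noteq> v \<longrightarrow> k_visible G X k u v)"

definition mu :: "nat \<Rightarrow> ('a, 'b) pre_digraph \<Rightarrow> nat" where
  "mu k G = Max {card X | X. X \<subseteq> verts G \<and> mutual_k_visible G k X}"

end

theory Submission
  imports Defs
begin

text \<open>
  Two vertices \<open>u\<close>, \<open>v\<close> determine the set of vertices separating them. In a block graph it is the
  set of inner vertices of every shortest path from \<open>u\<close> to \<open>v\<close>; it is also the set of cut vertices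
  strictly between two nodes of the block-cutpoint tree that own \<open>u\<close> and \<open>v\<close>, where a cut vertex
  owns itself and a block owns its vertices that are not cut vertices. Hence visibility in a
  set \<open>X\<close> translates into admissibility of the set of nodes that own some vertex of \<open>X\<close>, and
  conversely. Both descriptions of the separators, and the uniqueness of paths in the tree, rest on
  one fact: two different blocks sharing a vertex \<open>w\<close> lie in different components of \<open>G - w\<close>,
  since otherwise a cycle through \<open>w\<close> would join them.
\<close>

section \<open>Connectivity of vertex sets\<close>

definition connected_on :: "'a rel \<Rightarrow> 'a set \<Rightarrow> bool" where
  "connected_on E S \<longleftrightarrow> (\<forall>x\<in>S. \<forall>y\<in>S. (x, y) \<in> (E \<inter> S \<times> S)\<^sup>*)"

text \<open>The empty set counts as \<open>connected_on\<close>, so singletons qualify, in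
  accordance with the one-vertex graph having no cut vertex.\<close>

definition biconnected_on :: "'a rel \<Rightarrow> 'a set \<Rightarrow> bool" where
  "biconnected_on E S \<longleftrightarrow> S \<noteq> {} \<and> connected_on E S \<and> (\<forall>z\<in>S. connected_on E (S - {z}))"

lemma connected_onI_clique:
  assumes "\<And>x y. x \<in> S \<Longrightarrow> y \<in> S \<Longrightarrow> x \<noteq> y \<Longrightarrow> (x, y) \<in> E"
  shows "connected_on E S"
  unfolding connected_on_def
proof (intro ballI)
  fix x y assume "x \<in> S" "y \<in> S"
  then show "(x, y) \<in> (E \<inter> S \<times> S)\<^sup>*"
    using assms by (cases "x = y") auto
qed

lemma connected_on_Un:
  assumes S: "connected_on E S" and T: "connected_on E T" and ne: "S \<inter> T \<noteq> {}"
  shows "connected_on E (S \<union> T)"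
proof -
  obtain c where c: "c \<in> S" "c \<in> T" using ne by blast
  let ?R = "(E \<inter> (S \<union> T) \<times> (S \<union> T))\<^sup>*"
  have sub: "(E \<inter> S \<times> S)\<^sup>* \<subseteq> ?R" "(E \<inter> T \<times> T)\<^sup>* \<subseteq> ?R"
    by (auto intro!: rtrancl_mono)
  have "(x, c) \<in> ?R" "(c, x) \<in> ?R" if "x \<in> S \<union> T" for x
    using that S T c sub unfolding connected_on_def by blast+
  then show ?thesis
    unfolding connected_on_def by (blast intro: rtrancl_trans)
qed

lemma connected_on_successively:
  assumes "sym E" "successively (\<lambda>a b. (a, b) \<in> E) xs"
  shows "connected_on E (set xs)"
  using assms(2)
proof (induction xs rule: induct_list012)
  case (3 x y zs)
  then have "(x, y) \<in> E" "(y, x) \<in> E"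
    using assms(1) by (auto dest: symD)
  then have "connected_on E {x, y}"
    by (intro connected_onI_clique) auto
  moreover have "connected_on E (set (y # zs))"
    using 3 by simp
  ultimately have "connected_on E ({x, y} \<union> set (y # zs))"
    by (rule connected_on_Un) simp
  then show ?case by (simp add: insert_commute insert_absorb)
qed (simp_all add: connected_on_def)

lemma biconnected_onI_clique:
  assumes "S \<noteq> {}" "\<And>x y. x \<in> S \<Longrightarrow> y \<in> S \<Longrightarrow> x \<noteq> y \<Longrightarrow> (x, y) \<in> E"
  shows "biconnected_on E S"
  unfolding biconnected_on_def using assms by (auto intro!: connected_onI_clique)

text \<open>Two cliques stay glued after any deletion: of the two common vertices \<open>a\<close>
  and \<open>b\<close> at least one survives.\<close>

lemma biconnected_on_Un_cliques:
  assumes S: "\<And>x y. x \<in> S \<Longrightarrow> y \<in> S \<Longrightarrow> x \<noteq> y \<Longrightarrow> (x, y) \<in> E"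
    and T: "\<And>x y. x \<in> T \<Longrightarrow> y \<in> T \<Longrightarrow> x \<noteq> y \<Longrightarrow> (x, y) \<in> E"
    and ab: "a \<in> S \<inter> T" "b \<in> S \<inter> T" "a \<noteq> b"
  shows "biconnected_on E (S \<union> T)"
  unfolding biconnected_on_def
proof (intro conjI ballI)
  show "S \<union> T \<noteq> {}" using ab by auto
  show "connected_on E (S \<union> T)"
    using S T ab by (intro connected_on_Un connected_onI_clique) auto
  fix z
  have "(S - {z}) \<inter> (T - {z}) \<noteq> {}" using ab by blast
  then have "connected_on E ((S - {z}) \<union> (T - {z}))"
    using S T by (intro connected_on_Un connected_onI_clique) auto
  then show "connected_on E (S \<union> T - {z})" by (simp add: Un_Diff)
qed

text \<open>Deleting a vertex of a cycle leaves a path. If the deleted vertex is not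
  \<open>w\<close>, the two remaining pieces of \<open>xs\<close> are joined through
  \<open>w\<close>. A single vertex in \<open>xs\<close> is allowed; the cycle then degenerates to
  an edge.\<close>

lemma biconnected_on_cycle:
  assumes sym: "sym E" and walk: "successively (\<lambda>a b. (a, b) \<in> E) xs" and "xs \<noteq> []"
    and dist: "distinct (w # xs)" and ends: "(w, hd xs) \<in> E" "(last xs, w) \<in> E"
  shows "biconnected_on E (insert w (set xs))"
  unfolding biconnected_on_def
proof (intro conjI ballI)
  have "connected_on E (set (w # xs))"
    using walk ends \<open>xs \<noteq> []\<close>
    by (intro connected_on_successively[OF sym]) (simp add: successively_Cons)
  then show "connected_on E (insert w (set xs))" by simp
  fix z assume z: "z \<in> insert w (set xs)"
  show "connected_on E (insert w (set xs) - {z})"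
  proof (cases "z = w")
    case True
    then have "insert w (set xs) - {z} = set xs" using dist by auto
    then show ?thesis using connected_on_successively[OF sym walk] by simp
  next
    case False
    then obtain ys zs where xs: "xs = ys @ z # zs"
      using z by (auto simp: in_set_conv_decomp)
    have "successively (\<lambda>a b. (a, b) \<in> E) (w # ys)"
      using walk ends by (cases ys) (auto simp: xs successively_append_iff successively_Cons hd_append
          split: if_splits)
    moreover have "successively (\<lambda>a b. (a, b) \<in> E) (zs @ [w])"
      using walk ends
      by (cases "zs = []") (auto simp: xs successively_append_iff successively_Cons)
    ultimately have "connected_on E (set (w # ys) \<union> set (zs @ [w]))"
      by (intro connected_on_Un connected_on_successively[OF sym]) auto
    moreover have "set (w # ys) \<union> set (zs @ [w]) = insert w (set xs) - {z}"
      using dist False by (auto simp: xs)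
    ultimately show ?thesis by simp
  qed
qed simp

lemma rtrancl_imp_distinct_walk:
  assumes "(x, y) \<in> R\<^sup>*"
  obtains xs where "xs \<noteq> []" "hd xs = x" "last xs = y" "distinct xs"
    "successively (\<lambda>a b. (a, b) \<in> R) xs"
proof -
  have "\<exists>xs. xs \<noteq> [] \<and> hd xs = x \<and> last xs = y \<and> distinct xs
      \<and> successively (\<lambda>a b. (a, b) \<in> R) xs"
    using assms
  proof (induction rule: converse_rtrancl_induct)
    case base
    show ?case by (rule exI[of _ "[y]"]) simp
  next
    case (step x z)
    then obtain xs where xs: "xs \<noteq> []" "hd xs = z" "last xs = y" "distinct xs"
      "successively (\<lambda>a b. (a, b) \<in> R) xs" by blast
    show ?case
    proof (cases "x \<in> set xs")
      case True
      then obtain ys zs where "xs = ys @ x # zs" by (auto simp: in_set_conv_decomp)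
      then show ?thesis
        using xs by (intro exI[of _ "x # zs"]) (auto simp: successively_append_iff)
    next
      case False
      then show ?thesis
        using xs step by (intro exI[of _ "x # xs"]) (auto simp: successively_Cons)
    qed
  qed
  then show thesis using that by blast
qed

text \<open>The witness \<open>z\<close> is the successor of the last visit to \<open>x\<close>,
  after which the walk never returns there.\<close>

lemma rtrancl_last_departure:
  assumes "(x, y) \<in> R\<^sup>*" "x \<noteq> y"
  shows "\<exists>z. (x, z) \<in> R \<and> z \<noteq> x \<and> (z, y) \<in> {(a, b) \<in> R. a \<noteq> x \<and> b \<noteq> x}\<^sup>*"
  using assms
proof (induction rule: rtrancl_induct)
  case (step y z)
  then show ?case
    by (cases "x = y") (auto intro: rtrancl_into_rtrancl)
qed simp

section \<open>Walks avoiding a vertex\<close>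

text \<open>The closure \<open>(avoiding G w)\<^sup>*\<close> expresses connectivity in
  \<open>G - w\<close>, but being reflexive it also relates \<open>w\<close> to itself; hence the
  conditions \<open>x \<noteq> w\<close> in later lemmas.\<close>

definition avoiding :: "('a, 'b) pre_digraph \<Rightarrow> 'a \<Rightarrow> 'a rel" where
  "avoiding G w = {(x, y) \<in> arcs_ends G. x \<noteq> w \<and> y \<noteq> w}"

lemma sym_avoiding: "symmetric G \<Longrightarrow> sym (avoiding G w)"
  by (auto simp: avoiding_def symmetric_def sym_def)

lemma avoiding_rtrancl_sym:
  "symmetric G \<Longrightarrow> (x, y) \<in> (avoiding G w)\<^sup>* \<Longrightarrow> (y, x) \<in> (avoiding G w)\<^sup>*"
  by (rule symD[OF sym_rtrancl[OF sym_avoiding]])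

lemma (in wf_digraph) awalk_imp_avoiding:
  assumes "awalk u p v" "w \<notin> set (awalk_verts u p)"
  shows "(u, v) \<in> (avoiding G w)\<^sup>*"
  using assms
proof (induction p arbitrary: u)
  case (Cons e es)
  then have e: "e \<in> arcs G" "u = tail G e" "awalk (head G e) es v" "u \<noteq> w"
    "w \<notin> set (awalk_verts (head G e) es)"
    by (auto simp: awalk_Cons_iff)
  then have "head G e \<noteq> w" using hd_in_awalk_verts by blast
  then have "(u, head G e) \<in> avoiding G w"
    using e by (auto simp: avoiding_def intro: in_arcs_imp_in_arcs_ends)
  moreover have "(head G e, v) \<in> (avoiding G w)\<^sup>*" using Cons.IH e by blast
  ultimately show ?case by (rule converse_rtrancl_into_rtrancl)
qed (simp add: awalk_Nil_iff)

text \<open>In a tree every vertex separates its neighbours; conversely two paths that part at a vertex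
  would join two of its neighbours while avoiding it.\<close>
lemma (in nomulti_digraph) apath_unique:
  assumes sym: "symmetric G"
    and sep: "\<And>c x y. (c, x) \<in> arcs_ends G \<Longrightarrow> (c, y) \<in> arcs_ends G
      \<Longrightarrow> (x, y) \<in> (avoiding G c)\<^sup>* \<Longrightarrow> x = y"
  assumes "apath u p v" "apath u q v"
  shows "p = q"
  using assms(3,4)
proof (induction p arbitrary: u q)
  case Nil
  then show ?case using apath_nonempty_ends by (auto simp: apath_Nil_iff)
next
  case (Cons e p)
  note path = Cons.prems
  have "u \<noteq> v" using path(1) apath_nonempty_ends by blast
  then obtain f q' where q: "q = f # q'"
    using path(2) by (cases q) (auto simp: apath_Nil_iff)
  have e: "e \<in> arcs G" "tail G e = u" "apath (head G e) p v" "u \<notin> set (awalk_verts (head G e) p)"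
    and f: "f \<in> arcs G" "tail G f = u" "apath (head G f) q' v" "u \<notin> set (awalk_verts (head G f) q')"
    using path by (auto simp: q apath_Cons_iff)
  have "(head G e, v) \<in> (avoiding G u)\<^sup>*" "(head G f, v) \<in> (avoiding G u)\<^sup>*"
    using e f awalk_imp_avoiding awalkI_apath by blast+
  then have "(head G e, head G f) \<in> (avoiding G u)\<^sup>*"
    using avoiding_rtrancl_sym[OF sym] by (blast intro: rtrancl_trans)
  moreover have "(u, head G e) \<in> arcs_ends G" "(u, head G f) \<in> arcs_ends G"
    using e(1,2) f(1,2) by (metis in_arcs_imp_in_arcs_ends)+
  ultimately have "head G e = head G f" using sep by blast
  then have "e = f" using e f by (intro no_multi_arcs) (auto simp: arc_to_ends_def)
  then show ?case using Cons.IH e f q by simp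
qed

text \<open>A path meets \<open>w\<close> only once, entering by \<open>e\<close> and leaving by
  \<open>f\<close>, so the two outer pieces avoid \<open>w\<close> and the neighbours on both sides
  differ. This serves paths in the graph and in the tree alike.\<close>

lemma (in wf_digraph) apath_split_inner:
  assumes path: "apath u p v" and w: "w \<in> set (awalk_verts u p)" "w \<noteq> u" "w \<noteq> v"
  obtains q e f r where "p = q @ e # f # r" "e \<in> arcs G" "f \<in> arcs G" "head G e = w" "tail G f = w"
    "tail G e \<noteq> head G f" "awalk u q (tail G e)" "w \<notin> set (awalk_verts u q)"
    "awalk (head G f) r v" "w \<notin> set (awalk_verts (head G f) r)"
proof -
  obtain q' r' where p: "p = q' @ r'" and q': "awalk u q' w" and r': "awalk w r' v"
    using awalk_decomp[OF awalkI_apath[OF path] w(1)] by blast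
  have "q' \<noteq> []" "r' \<noteq> []" using q' r' w by (auto simp: awalk_Nil_iff)
  then obtain q e f r where qr: "q' = q @ [e]" "r' = f # r"
    by (metis list.exhaust rev_exhaust)
  have e: "awalk u q (tail G e)" "e \<in> arcs G" "head G e = w"
    using q' by (auto simp: qr awalk_Cons_iff awalk_Nil_iff)
  have f: "awalk (head G f) r v" "f \<in> arcs G" "tail G f = w"
    using r' by (auto simp: qr awalk_Cons_iff)
  have "awlast u q = tail G e" using e(1) by auto
  moreover have "apath u (q @ e # f # r) v" using path by (simp add: p qr)
  ultimately have disj: "set (awalk_verts u q) \<inter> insert w (set (awalk_verts (head G f) r)) = {}"
    and wr: "w \<notin> set (awalk_verts (head G f) r)"
    using e(3) f(3) by (auto simp: apath_append_iff apath_Cons_iff)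
  have "tail G e \<in> set (awalk_verts u q)"
    using \<open>awlast u q = tail G e\<close> last_in_set[OF awalk_verts_non_Nil, of u q] by simp
  moreover have "head G f \<in> set (awalk_verts (head G f) r)"
    using f(1) by (rule hd_in_awalk_verts)
  ultimately have "tail G e \<noteq> head G f" "w \<notin> set (awalk_verts u q)"
    using disj by auto
  then show thesis using that[of q e f r] e f p qr wr by simp
qed

text \<open>The arc \<open>g\<close> brings in no new vertex, so distinctness is inherited while the
  length drops by one.\<close>

lemma (in wf_digraph) apath_shortcut:
  assumes path: "apath u (q @ e # f # r) v"
    and g: "g \<in> arcs G" "tail G g = tail G e" "head G g = head G f"
  shows "apath u (q @ g # r) v"
proof -
  have "awlast u q = tail G e" using path by (simp add: apath_append_iff apath_Cons_iff)
  then show ?thesis using path g by (auto simp: apath_append_iff apath_Cons_iff)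
qed

section \<open>Blocks\<close>

lemma arcs_ends_induce_subgraph: "arcs_ends (G \<restriction> S) = arcs_ends G \<inter> S \<times> S"
  by (auto simp: arcs_ends_def arc_to_ends_def)

lemma strongly_connected_induce_subgraph:
  assumes "wf_digraph G" "connected_on (arcs_ends G) S" "S \<noteq> {}"
  shows "strongly_connected (G \<restriction> S)"
proof -
  interpret S: wf_digraph "G \<restriction> S"
    using assms(1) by (rule wf_digraph.wellformed_induce_subgraph)
  show ?thesis
    using assms(2,3)
    by (auto simp: strongly_connected_def connected_on_def S.reachable_conv arcs_ends_induce_subgraph)
qed

lemma (in wf_digraph) card_sccs_strongly_connected:
  "strongly_connected G \<Longrightarrow> card sccs = 1"
  by (simp add: strongly_connected_eq_iff)

lemma del_vert_eq_induce_subgraph: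
  assumes "wf_digraph G" shows "pre_digraph.del_vert G v = G \<restriction> (verts G - {v})"
  using assms
  by (auto simp: pre_digraph.del_vert_def induce_subgraph_def wf_digraph.tail_in_verts
      wf_digraph.head_in_verts)

text \<open>Needed when the only vertex of a graph is deleted: no component remains.\<close>

lemma sccs_empty_verts: "verts G = {} \<Longrightarrow> pre_digraph.sccs G = {}"
  by (auto simp: pre_digraph.sccs_def strongly_connected_def induced_subgraph_def subgraph_def)

section \<open>Biconnected vertex sets and blocks of an arbitrary graph\<close>

context graph
begin

lemma graph_induce_subgraph:
  assumes "S \<subseteq> verts G" shows "graph (G \<restriction> S)"
proof -
  have ind: "induced_subgraph (G \<restriction> S) G" using assms by (rule induced_induce)
  interpret S: digraph "G \<restriction> S" using ind by (rule digraphI_induced)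
  show ?thesis using induced_graph_imp_symmetric[OF sym_arcs ind] by (rule S.graphI)
qed

text \<open>The induced subgraph has exactly one component and every deletion leaves at most one, so
  the number of components never increases.\<close>

lemma cut_verts_biconnected:
  assumes S: "S \<subseteq> verts G" "biconnected_on (arcs_ends G) S"
  shows "cut_verts (G \<restriction> S) = {}"
proof -
  interpret S: graph "G \<restriction> S" using S(1) by (rule graph_induce_subgraph)
  have "card S.sccs = 1"
    using S(2) S.card_sccs_strongly_connected strongly_connected_induce_subgraph[OF wf_digraph]
    by (simp add: biconnected_on_def)
  moreover have "card (pre_digraph.sccs (S.del_vert v)) \<le> 1" if v: "v \<in> S" for v
  proof (cases "S - {v} = {}")
    case True
    then have "pre_digraph.sccs (S.del_vert v) = {}"
      by (intro sccs_empty_verts) (simp add: S.verts_del_vert)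
    then show ?thesis by simp
  next
    case False
    have "connected_on (arcs_ends (G \<restriction> S)) (S - {v})"
      using S(2) v unfolding biconnected_on_def connected_on_def arcs_ends_induce_subgraph
      by (simp add: Int_assoc) (metis Diff_subset Int_absorb1 Sigma_mono)
    then have "strongly_connected ((G \<restriction> S) \<restriction> (S - {v}))"
      using False by (intro strongly_connected_induce_subgraph S.wf_digraph)
    moreover have "S.del_vert v = (G \<restriction> S) \<restriction> (S - {v})"
      using del_vert_eq_induce_subgraph[OF S.wf_digraph] by simp
    ultimately show ?thesis
      by (metis S.wf_digraph_del_vert order_refl wf_digraph.card_sccs_strongly_connected)
  qed
  ultimately show ?thesis by (force simp: cut_verts_def)
qed

text \<open>The subgraph induced by \<open>S\<close> has the properties required of a block, and in
  a finite graph it extends to a largest subgraph with these properties, which is then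
  maximal.\<close>

lemma biconnected_subset_block:
  assumes S: "S \<subseteq> verts G" "biconnected_on (arcs_ends G) S"
  obtains B where "B \<in> blocks G" "S \<subseteq> verts B"
proof -
  let ?P = "\<lambda>B :: ('a, 'b) pre_digraph. graph B \<and> connected B \<and> cut_verts B = {}"
  let ?Q = "\<lambda>B. subgraph (G \<restriction> S) B \<and> subgraph B G \<and> ?P B"
  \<comment> \<open>Arcs are counted too, because a proper subgraph may have all the
    vertices.\<close>
  let ?m = "\<lambda>B :: ('a, 'b) pre_digraph. card (verts B) + card (arcs B)"
  interpret S: graph "G \<restriction> S" using S(1) by (rule graph_induce_subgraph)
  have "strongly_connected (G \<restriction> S)"
    using S(2) by (intro strongly_connected_induce_subgraph wf_digraph)
      (auto simp: biconnected_on_def)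
  then have "connected (G \<restriction> S)"
    by (auto intro!: S.connectedI S.reachable_mk_symmetricI simp: strongly_connected_def)
  then have Q: "?Q (G \<restriction> S)"
    using S.subgraph_refl subgraph_induce_subgraphI[OF S(1)] cut_verts_biconnected[OF S]
      S.graph_axioms by blast
  have fin: "finite (verts G)" "finite (arcs G)" by auto
  have bound: "?m B \<le> ?m G" if "?Q B" for B
    using that fin by (intro add_mono card_mono) auto
  then have "\<forall>B. ?Q B \<longrightarrow> ?m B < Suc (?m G)" by (auto simp: less_Suc_eq_le)
  then obtain B where B: "?Q B" "\<And>C. ?Q C \<Longrightarrow> ?m C \<le> ?m B"
    using ex_has_greatest_nat[of ?Q "G \<restriction> S" ?m] Q by blast
  have "B \<in> blocks G"
    unfolding blocks_def mem_Collect_eq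
  proof (rule max_subgraphI)
    fix C assume C: "B \<noteq> C" "subgraph B C" "subgraph C G"
    show "\<not> ?P C"
    proof
      assume "?P C"
      then have "?m C \<le> ?m B" using B C subgraph_trans by blast
      moreover have "finite (verts C)" "finite (arcs C)"
        using C(3) fin by (meson finite_subset subgraphE)+
      moreover have sub: "verts B \<subseteq> verts C" "arcs B \<subseteq> arcs C" using C(2) by auto
      ultimately have "verts B = verts C" "arcs B = arcs C"
        using card_mono[of "verts C" "verts B"] card_mono[of "arcs C" "arcs B"]
          card_subset_eq[of "verts C" "verts B"] card_subset_eq[of "arcs C" "arcs B"]
        by auto
      moreover have "tail B = tail C" "head B = head C"
        using C(2) by (auto simp: subgraph_def compatible_def)
      ultimately show False using C(1) by simp
    qed
  qed (use B in auto)
  moreover have "S \<subseteq> verts B" using B(1) subgraph_imp_subverts[of "G \<restriction> S" B] by simp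
  ultimately show thesis using that by blast
qed

end

section \<open>Blocks of a connected block graph, as cliques that meet in at most one vertex\<close>

locale connected_block_graph = graph G for G :: "('a, 'b) pre_digraph" +
  assumes connected: "connected G" and block_graph: "block_graph G"
begin

lemma adj_sym: "(x, y) \<in> arcs_ends G \<Longrightarrow> (y, x) \<in> arcs_ends G"
  by (rule graph_symmetric)

lemma adj_neq: "(x, y) \<in> arcs_ends G \<Longrightarrow> x \<noteq> y"
  using adj_not_same by blast

lemma block_subgraph: "B \<in> blocks G \<Longrightarrow> subgraph B G"
  by (auto simp: blocks_def max_subgraph_def)

lemma block_verts: "B \<in> blocks G \<Longrightarrow> verts B \<subseteq> verts G"
  by (rule subgraph_imp_subverts[OF block_subgraph])

lemma block_arcs_ends:
  assumes "B \<in> blocks G" "x \<in> verts B" "y \<in> verts B" "x \<noteq> y"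
  shows "(x, y) \<in> arcs_ends B"
  using assms block_graph by (auto simp: block_graph_def complete_digraph_def)

lemma block_adj:
  assumes "B \<in> blocks G" "x \<in> verts B" "y \<in> verts B" "x \<noteq> y"
  shows "(x, y) \<in> arcs_ends G"
  using block_arcs_ends[OF assms] arcs_ends_mono[OF block_subgraph[OF assms(1)]] by blast

lemma block_avoiding:
  assumes "B \<in> blocks G" "x \<in> verts B" "y \<in> verts B" "x \<noteq> w" "y \<noteq> w"
  shows "(x, y) \<in> (avoiding G w)\<^sup>*"
  using block_adj[OF assms(1-3)] assms(4,5) by (cases "x = y") (auto simp: avoiding_def)

text \<open>Since \<open>C\<close> is complete and \<open>G\<close> has no parallel arcs, each arc
  of \<open>B\<close> is the very arc that \<open>C\<close> has between the same ends. So
  \<open>B\<close> is a subgraph of \<open>C\<close>, and maximality applies.\<close>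

lemma block_eq_if_subset:
  assumes B: "B \<in> blocks G" and C: "C \<in> blocks G" and sub: "verts B \<subseteq> verts C"
  shows "B = C"
proof -
  have BG: "subgraph B G" and CG: "subgraph C G" using B C block_subgraph by auto
  have ends: "tail B = tail G" "head B = head G" "tail C = tail G" "head C = head G"
    using BG CG by (auto simp: subgraph_def compatible_def)
  have "arcs B \<subseteq> arcs C"
  proof
    fix e assume e: "e \<in> arcs B"
    then have eG: "e \<in> arcs G" using BG by auto
    have "tail G e \<in> verts C" "head G e \<in> verts C"
      using e BG sub wf_digraph.wellformed[of B e] ends by (auto simp: subgraph_def)
    then have "(tail G e, head G e) \<in> arcs_ends C"
      using block_arcs_ends[OF C] no_loops[OF eG] by blast
    then obtain f where f: "f \<in> arcs C" "tail G f = tail G e" "head G f = head G e"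
      using ends by (auto simp: arcs_ends_def arc_to_ends_def)
    moreover have "f \<in> arcs G" using f CG by auto
    ultimately show "e \<in> arcs C" using no_multi_arcs[of f e] eG by (auto simp: arc_to_ends_def)
  qed
  then have "subgraph B C"
    using sub BG CG ends by (auto simp: subgraph_def compatible_def)
  then show ?thesis using B C by (auto simp: blocks_def intro: max_subgraph_subg_eq)
qed

text \<open>The union of the two cliques is biconnected, hence inside a single block, which must
  equal both.\<close>

lemma block_eq_if_two_common:
  assumes B: "B \<in> blocks G" and C: "C \<in> blocks G"
    and xy: "x \<in> verts B" "x \<in> verts C" "y \<in> verts B" "y \<in> verts C" "x \<noteq> y"
  shows "B = C"
proof -
  have "biconnected_on (arcs_ends G) (verts B \<union> verts C)"
    using block_adj[OF B] block_adj[OF C] xy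
    by (intro biconnected_on_Un_cliques[where a = x and b = y]) auto
  then obtain D where D: "D \<in> blocks G" "verts B \<union> verts C \<subseteq> verts D"
    using biconnected_subset_block block_verts B C by (metis Un_least)
  then have "B = D" "C = D" using B C block_eq_if_subset by auto
  then show ?thesis by simp
qed

lemma ex_block_vertex:
  assumes "v \<in> verts G" obtains B where "B \<in> blocks G" "v \<in> verts B"
proof -
  have "biconnected_on (arcs_ends G) {v}" by (rule biconnected_onI_clique) auto
  then show thesis using biconnected_subset_block[of "{v}"] assms that by auto
qed

lemma ex_block_edge:
  assumes "(x, y) \<in> arcs_ends G" obtains B where "B \<in> blocks G" "x \<in> verts B" "y \<in> verts B"
proof -
  have "biconnected_on (arcs_ends G) {x, y}"
    using assms adj_sym by (intro biconnected_onI_clique) auto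
  moreover have "{x, y} \<subseteq> verts G" using adj_in_verts[OF assms] by simp
  ultimately show thesis using biconnected_subset_block that by (metis insert_subset)
qed

text \<open>A path between two neighbours of \<open>w\<close> that avoids \<open>w\<close> closes to a cycle.\<close>
lemma ex_block_neighbours:
  assumes wx: "(w, x) \<in> arcs_ends G" and wy: "(w, y) \<in> arcs_ends G"
    and conn: "(x, y) \<in> (avoiding G w)\<^sup>*"
  obtains B where "B \<in> blocks G" "w \<in> verts B" "x \<in> verts B" "y \<in> verts B"
proof -
  obtain xs where xs: "xs \<noteq> []" "hd xs = x" "last xs = y" "distinct xs"
    and walk: "successively (\<lambda>a b. (a, b) \<in> avoiding G w) xs"
    using rtrancl_imp_distinct_walk[OF conn] by blast
  \<comment> \<open>The condition on the head covers a walk of one vertex, for which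
    \<open>successively\<close> says nothing.\<close>
  have "successively (\<lambda>a b. (a, b) \<in> avoiding G w) ys \<Longrightarrow> hd ys \<noteq> w \<Longrightarrow> w \<notin> set ys"
    if "ys \<noteq> []" for ys
    using that by (induction ys rule: induct_list012) (auto simp: avoiding_def)
  then have "w \<notin> set xs" using xs walk adj_neq[OF wx] by blast
  moreover have "successively (\<lambda>a b. (a, b) \<in> arcs_ends G) xs"
    using walk by (rule successively_mono) (auto simp: avoiding_def)
  ultimately have "biconnected_on (arcs_ends G) (insert w (set xs))"
    using xs wx adj_sym[OF wy] sym_arcs
    by (intro biconnected_on_cycle) (auto simp: symmetric_def)
  moreover have "insert w (set xs) \<subseteq> verts G"
  proof -
    have "successively (\<lambda>a b. (a, b) \<in> avoiding G w) ys \<Longrightarrow> hd ys \<in> verts G \<Longrightarrow> set ys \<subseteq> verts G"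
      for ys
      by (induction ys rule: induct_list012) (auto simp: avoiding_def dest: adj_in_verts)
    then show ?thesis using walk xs adj_in_verts[OF wx] by simp
  qed
  ultimately obtain B where "B \<in> blocks G" "insert w (set xs) \<subseteq> verts B"
    using biconnected_subset_block by metis
  then show thesis using that xs hd_in_set[of xs] last_in_set[of xs] by auto
qed

text \<open>Both \<open>x\<close> and \<open>y\<close> are neighbours of \<open>w\<close>, so some
  block contains all three; it shares \<open>w\<close>, \<open>x\<close> with \<open>B\<close> and
  \<open>w\<close>, \<open>y\<close> with \<open>C\<close>.\<close>

lemma blocks_separated:
  assumes B: "B \<in> blocks G" "w \<in> verts B" "x \<in> verts B" "x \<noteq> w"
    and C: "C \<in> blocks G" "w \<in> verts C" "y \<in> verts C" "y \<noteq> w"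
    and conn: "(x, y) \<in> (avoiding G w)\<^sup>*"
  shows "B = C"
proof -
  have "(w, x) \<in> arcs_ends G" "(w, y) \<in> arcs_ends G"
    using B C by (auto intro: block_adj)
  then obtain D where "D \<in> blocks G" "w \<in> verts D" "x \<in> verts D" "y \<in> verts D"
    using ex_block_neighbours conn by blast
  then show ?thesis
    using B C block_eq_if_two_common[of B D w x] block_eq_if_two_common[of C D w y] by auto
qed

text \<open>Otherwise \<open>B\<close> would lie inside \<open>C\<close> and hence equal it.\<close>

lemma ex_other_vertex_in_block:
  assumes "B \<in> blocks G" "C \<in> blocks G" "w \<in> verts C" "B \<noteq> C"
  obtains x where "x \<in> verts B" "x \<noteq> w"
  using block_eq_if_subset[of B C] assms by blast

text \<open>Vertices of the two blocks other than \<open>v\<close> end up in different components of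
  \<open>G - v\<close>, while \<open>G\<close> itself has only one component.\<close>

lemma cut_vert_if_two_blocks:
  assumes B: "B \<in> blocks G" "v \<in> verts B" and C: "C \<in> blocks G" "v \<in> verts C" and "B \<noteq> C"
  shows "v \<in> cut_verts G"
proof -
  obtain x where x: "x \<in> verts B" "x \<noteq> v"
    using ex_other_vertex_in_block B C \<open>B \<noteq> C\<close> by blast
  obtain y where y: "y \<in> verts C" "y \<noteq> v"
    using ex_other_vertex_in_block B C \<open>B \<noteq> C\<close> by metis
  interpret D: graph "del_vert v"
    using graph_induce_subgraph[of "verts G - {v}"] del_vert_eq_induce_subgraph[OF wf_digraph]
    by simp
  have vG: "v \<in> verts G" and xG: "x \<in> verts (del_vert v)" and yG: "y \<in> verts (del_vert v)"
    using B C x y block_verts by (auto simp: verts_del_vert)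
  have "arcs_ends (del_vert v) = avoiding G v"
    by (auto simp: arcs_ends_def arc_to_ends_def avoiding_def arcs_del_vert tail_del_vert
        head_del_vert)
  then have "\<not> x \<rightarrow>\<^sup>*\<^bsub>del_vert v\<^esub> y"
    using blocks_separated[OF B x C y] \<open>B \<noteq> C\<close> by (auto simp: D.reachable_conv)
  then have "D.scc_of x \<noteq> D.scc_of y"
    using D.in_scc_of_self[OF yG] by (auto simp: D.scc_of_def)
  then have "card {D.scc_of x, D.scc_of y} = 2" by simp
  moreover have "card {D.scc_of x, D.scc_of y} \<le> card D.sccs_verts"
    using D.finite_sccs_verts D.scc_of_in_sccs_verts xG yG by (intro card_mono) auto
  ultimately have "2 \<le> card D.sccs" by (simp add: D.card_sccs_verts)
  moreover have "card sccs = 1"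
    using symmetric_connected_imp_strongly_connected[OF sym_arcs connected]
    by (rule card_sccs_strongly_connected)
  ultimately show ?thesis using vG by (simp add: cut_verts_def)
qed

lemma cut_verts_subset: "cut_verts G \<subseteq> verts G"
  by (auto simp: cut_verts_def)


section \<open>Paths in the block-cutpoint tree\<close>

text \<open>Adjacent nodes of the tree share a vertex in this sense, which lets walks in the tree be
  followed in \<open>G\<close>.\<close>

fun node_verts :: "'a + ('a, 'b) pre_digraph \<Rightarrow> 'a set" where
  "node_verts (Inl v) = {v}"
| "node_verts (Inr B) = verts B"

text \<open>Over the nodes of the tree these sets are pairwise disjoint and cover
  \<open>verts G\<close>; a block consisting of cut vertices only owns nothing.\<close>

fun own_verts :: "'a + ('a, 'b) pre_digraph \<Rightarrow> 'a set" where
  "own_verts (Inl v) = {v}"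
| "own_verts (Inr B) = verts B - cut_verts G"

text \<open>The ends are excluded explicitly, since \<open>avoiding G w\<close> never joins
  \<open>w\<close> to another vertex.\<close>

definition separators :: "'a \<Rightarrow> 'a \<Rightarrow> 'a set" where
  "separators u v = {w. w \<noteq> u \<and> w \<noteq> v \<and> (u, v) \<notin> (avoiding G w)\<^sup>*}"

abbreviation "T \<equiv> block_cut_tree G"
abbreviation "H \<equiv> with_proj (block_cut_tree G)"

lemma own_subset_node_verts: "own_verts \<alpha> \<subseteq> node_verts \<alpha>"
  by (cases \<alpha>) auto

lemma H_arcE:
  assumes "(\<alpha>, \<beta>) \<in> arcs_ends H"
  obtains v B where "B \<in> blocks G" "v \<in> cut_verts G" "v \<in> verts B" "\<alpha> = Inl v" "\<beta> = Inr B"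
  | v B where "B \<in> blocks G" "v \<in> cut_verts G" "v \<in> verts B" "\<alpha> = Inr B" "\<beta> = Inl v"
  using assms by (auto simp: block_cut_tree_def)

lemma H_arcI:
  assumes "B \<in> blocks G" "v \<in> cut_verts G" "v \<in> verts B"
  shows "(Inl v, Inr B) \<in> arcs_ends H" "(Inr B, Inl v) \<in> arcs_ends H"
  using assms by (auto simp: block_cut_tree_def)

lemma H_arc_InlE:
  assumes "(Inl w, \<beta>) \<in> arcs_ends H"
  obtains B where "\<beta> = Inr B" "B \<in> blocks G" "w \<in> verts B" "w \<in> cut_verts G"
  using assms by (rule H_arcE) (use that in auto)

sublocale H: nomulti_digraph H
  by unfold_locales (auto simp: block_cut_tree_def arc_to_ends_def)

lemma H_symmetric: "symmetric H"
  unfolding symmetric_def sym_def by (auto simp: block_cut_tree_def)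

section \<open>Transfer of connectivity from the tree to the graph, and acyclicity of the
  tree\<close>

lemma node_verts_avoiding:
  assumes "\<alpha> \<in> pverts T" "x \<in> node_verts \<alpha>" "y \<in> node_verts \<alpha>" "x \<noteq> w" "y \<noteq> w"
  shows "(x, y) \<in> (avoiding G w)\<^sup>*"
  using assms block_avoiding by (cases \<alpha>) (auto simp: block_cut_tree_def)

text \<open>A step from a cut vertex into a block needs no move in \<open>G\<close>; a step from a
  block to a cut vertex \<open>c \<noteq> w\<close> is at most one edge of the clique, which avoids
  \<open>w\<close>.\<close>

lemma avoiding_H_imp_avoiding_G:
  assumes "(\<alpha>, \<beta>) \<in> (avoiding H (Inl w))\<^sup>*" "u \<in> node_verts \<alpha>" "u \<noteq> w"
  shows "\<exists>x \<in> node_verts \<beta>. x \<noteq> w \<and> (u, x) \<in> (avoiding G w)\<^sup>*"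
  using assms
proof (induction rule: rtrancl_induct)
  case (step \<beta> \<gamma>)
  then obtain x where x: "x \<in> node_verts \<beta>" "x \<noteq> w" "(u, x) \<in> (avoiding G w)\<^sup>*" by blast
  have "(\<beta>, \<gamma>) \<in> arcs_ends H" "\<gamma> \<noteq> Inl w" using step.hyps(2) by (auto simp: avoiding_def)
  then show ?case
  proof (cases rule: H_arcE)
    case (1 c B)
    then show ?thesis using x by auto
  next
    case (2 c B)
    then have "(x, c) \<in> (avoiding G w)\<^sup>*"
      using x \<open>\<gamma> \<noteq> Inl w\<close> by (intro block_avoiding[of B]) auto
    then have "(u, c) \<in> (avoiding G w)\<^sup>*" using x(3) by simp
    then show ?thesis using 2 \<open>\<gamma> \<noteq> Inl w\<close> by auto
  qed
qed auto

text \<open>This is the hypothesis of \<open>apath_unique\<close> for \<open>H\<close>. At a cut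
  vertex it reduces to \<open>blocks_separated\<close>. At a block the walk is examined at its
  starting cut vertex instead, where it must leave through another block.\<close>

lemma H_neighbours_separated:
  assumes cx: "(\<gamma>, \<alpha>) \<in> arcs_ends H" and cy: "(\<gamma>, \<beta>) \<in> arcs_ends H"
    and conn: "(\<alpha>, \<beta>) \<in> (avoiding H \<gamma>)\<^sup>*"
  shows "\<alpha> = \<beta>"
proof (cases \<gamma>)
  case (Inl w)
  obtain B where B: "\<alpha> = Inr B" "B \<in> blocks G" "w \<in> verts B"
    using cx unfolding Inl by (rule H_arc_InlE)
  obtain C where C: "\<beta> = Inr C" "C \<in> blocks G" "w \<in> verts C"
    using cy unfolding Inl by (rule H_arc_InlE)
  show ?thesis
  proof (rule ccontr)
    assume "\<alpha> \<noteq> \<beta>"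
    then obtain x where x: "x \<in> verts B" "x \<noteq> w"
      using B C ex_other_vertex_in_block by blast
    then obtain y where "y \<in> verts C" "y \<noteq> w" "(x, y) \<in> (avoiding G w)\<^sup>*"
      using avoiding_H_imp_avoiding_G[of \<alpha> \<beta> w x] conn Inl B C by auto
    then show False using blocks_separated[of B w x C y] B C x \<open>\<alpha> \<noteq> \<beta>\<close> by auto
  qed
next
  case (Inr B)
  obtain w where w: "\<alpha> = Inl w" "B \<in> blocks G" "w \<in> verts B"
    using cx Inr by (auto simp: block_cut_tree_def)
  obtain w' where w': "\<beta> = Inl w'" "w' \<in> verts B"
    using cy Inr by (auto simp: block_cut_tree_def)
  show ?thesis
  proof (rule ccontr)
    assume "\<alpha> \<noteq> \<beta>"
    \<comment> \<open>After its last departure from \<open>Inl w\<close> the walk also avoids that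
      node, so it can be transferred to \<open>G - w\<close>, joining the other block
      \<open>C\<close> to \<open>B\<close>.\<close>
    then obtain \<delta> where \<delta>: "(\<alpha>, \<delta>) \<in> avoiding H \<gamma>"
      and rest: "(\<delta>, \<beta>) \<in> {(a, b) \<in> avoiding H \<gamma>. a \<noteq> \<alpha> \<and> b \<noteq> \<alpha>}\<^sup>*"
      using rtrancl_last_departure[OF conn] by blast
    have "{(a, b) \<in> avoiding H \<gamma>. a \<noteq> \<alpha> \<and> b \<noteq> \<alpha>} \<subseteq> avoiding H (Inl w)"
      using w by (auto simp: avoiding_def)
    then have rest: "(\<delta>, \<beta>) \<in> (avoiding H (Inl w))\<^sup>*"
      using rest rtrancl_mono by blast
    obtain C where C: "\<delta> = Inr C" "C \<in> blocks G" "w \<in> verts C" "C \<noteq> B"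
      using \<delta> w Inr by (auto simp: avoiding_def block_cut_tree_def)
    obtain x where x: "x \<in> verts C" "x \<noteq> w"
      using ex_other_vertex_in_block[of C B w] C w by blast
    have "w' \<noteq> w" using \<open>\<alpha> \<noteq> \<beta>\<close> w w' by simp
    have "(x, w') \<in> (avoiding G w)\<^sup>*"
      using avoiding_H_imp_avoiding_G[OF rest] C x w' by auto
    then show False
      using blocks_separated[of C w x B w'] C x w w' \<open>w' \<noteq> w\<close> by auto
  qed
qed

section \<open>Connectedness of the block-cutpoint tree\<close>

lemma H_block_vertex_reachable:
  assumes "B \<in> blocks G" "C \<in> blocks G" "v \<in> verts B" "v \<in> verts C"
  shows "(Inr B, Inr C) \<in> (arcs_ends H)\<^sup>*"
proof (cases "B = C")
  case False
  then have "v \<in> cut_verts G" using assms cut_vert_if_two_blocks by blast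
  then have "(Inr B, Inl v) \<in> arcs_ends H" "(Inl v, Inr C) \<in> arcs_ends H"
    using assms H_arcI by blast+
  then show ?thesis by (meson r_into_rtrancl rtrancl_trans)
qed simp

text \<open>Each edge of the walk lies in a block, and the blocks of consecutive edges share a
  vertex.\<close>

lemma H_blocks_reachable:
  assumes "(u, v) \<in> (arcs_ends G)\<^sup>*" "B \<in> blocks G" "u \<in> verts B" "C \<in> blocks G" "v \<in> verts C"
  shows "(Inr B, Inr C) \<in> (arcs_ends H)\<^sup>*"
  using assms
proof (induction arbitrary: C rule: rtrancl_induct)
  case base
  then show ?case by (intro H_block_vertex_reachable)
next
  case (step y z)
  then obtain D where D: "D \<in> blocks G" "y \<in> verts D" "z \<in> verts D"
    using ex_block_edge by blast
  then have "(Inr B, Inr D) \<in> (arcs_ends H)\<^sup>*" "(Inr D, Inr C) \<in> (arcs_ends H)\<^sup>*"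
    using step H_block_vertex_reachable by blast+
  then show ?case by (rule rtrancl_trans)
qed

lemma H_node_block_reachable:
  assumes "\<alpha> \<in> pverts T"
  obtains B where "B \<in> blocks G" "(\<alpha>, Inr B) \<in> (arcs_ends H)\<^sup>*" "(Inr B, \<alpha>) \<in> (arcs_ends H)\<^sup>*"
proof (cases \<alpha>)
  case (Inl v)
  then have v: "v \<in> cut_verts G" using assms by (auto simp: block_cut_tree_def)
  then obtain B where "B \<in> blocks G" "v \<in> verts B"
    using ex_block_vertex cut_verts_subset by blast
  then show ?thesis using that H_arcI[of B v] v Inl by blast
next
  case (Inr B)
  then show ?thesis using that assms by (auto simp: block_cut_tree_def)
qed

lemma reachable_G:
  assumes "u \<in> verts G" "v \<in> verts G" shows "u \<rightarrow>\<^sup>*\<^bsub>G\<^esub> v"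
  using symmetric_connected_imp_strongly_connected[OF sym_arcs connected] assms
  by (auto simp: strongly_connected_def)

lemma block_nonempty:
  assumes "B \<in> blocks G" obtains x where "x \<in> verts B"
  using assms by (auto simp: blocks_def max_subgraph_def connected_conv)

lemma ex_H_apath:
  assumes "\<alpha> \<in> pverts T" "\<beta> \<in> pverts T"
  obtains p where "H.apath \<alpha> p \<beta>"
proof -
  obtain B where B: "B \<in> blocks G" "(\<alpha>, Inr B) \<in> (arcs_ends H)\<^sup>*"
    using H_node_block_reachable[OF assms(1)] by blast
  obtain C where C: "C \<in> blocks G" "(Inr C, \<beta>) \<in> (arcs_ends H)\<^sup>*"
    using H_node_block_reachable[OF assms(2)] by blast
  obtain x y where xy: "x \<in> verts B" "y \<in> verts C" using block_nonempty B C by metis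
  then have "x \<rightarrow>\<^sup>*\<^bsub>G\<^esub> y" using B C block_verts by (intro reachable_G) auto
  then have "(Inr B, Inr C) \<in> (arcs_ends H)\<^sup>*"
    using H_blocks_reachable B C xy by (auto simp: reachable_conv)
  then have "(\<alpha>, \<beta>) \<in> (arcs_ends H)\<^sup>*" using B C by (meson rtrancl_trans)
  then have "\<alpha> \<rightarrow>\<^sup>*\<^bsub>H\<^esub> \<beta>" using assms by (simp add: H.reachable_conv)
  then show thesis using that H.reachable_apath by blast
qed

text \<open>Uniqueness of paths makes the definite description denote the given path.\<close>

lemma tree_path_verts_eq:
  assumes "H.apath \<alpha> p \<beta>"
  shows "tree_path_verts T \<alpha> \<beta> = set (H.awalk_verts \<alpha> p)"
proof -
  have "(THE p. H.apath \<alpha> p \<beta>) = p"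
    using assms by (rule the_equality)
      (rule H.apath_unique[OF H_symmetric H_neighbours_separated _ assms])
  then show ?thesis by (simp add: tree_path_verts_def)
qed

lemma own_verts_neq_cut:
  "u \<in> own_verts \<alpha> \<Longrightarrow> w \<in> cut_verts G \<Longrightarrow> \<alpha> \<noteq> Inl w \<Longrightarrow> u \<noteq> w"
  by (cases \<alpha>) auto

text \<open>A path through \<open>Inl w\<close> passes between two different blocks at
  \<open>w\<close>, one connected to \<open>u\<close> and the other to \<open>v\<close> in
  \<open>G - w\<close>, and these are separated. Conversely, a tree path missing
  \<open>Inl w\<close> yields a connection of \<open>u\<close> and \<open>v\<close> in
  \<open>G - w\<close>.\<close>

lemma tree_path_inner_cut_verts:
  assumes \<alpha>: "\<alpha> \<in> pverts T" "u \<in> own_verts \<alpha>" and \<beta>: "\<beta> \<in> pverts T" "v \<in> own_verts \<beta>"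
  shows "(tree_path_verts T \<alpha> \<beta> - {\<alpha>, \<beta>}) \<inter> Inl ` cut_verts G = Inl ` separators u v"
proof -
  obtain p where p: "H.apath \<alpha> p \<beta>" using ex_H_apath \<alpha> \<beta> by blast
  note pw = H.awalkI_apath[OF p]
  have node: "u \<in> node_verts \<alpha>" "v \<in> node_verts \<beta>"
    using \<alpha> \<beta> own_subset_node_verts by blast+
  have "w \<in> separators u v"
    if w: "Inl w \<in> set (H.awalk_verts \<alpha> p)" "Inl w \<noteq> \<alpha>" "Inl w \<noteq> \<beta>" "w \<in> cut_verts G" for w
  proof -
    have neq: "w \<noteq> u" "w \<noteq> v" using own_verts_neq_cut w \<alpha> \<beta> by metis+
    obtain q e f r where e: "e \<in> arcs H" "head H e = Inl w" and f: "f \<in> arcs H" "tail H f = Inl w"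
      and ef: "tail H e \<noteq> head H f"
      and q: "H.awalk \<alpha> q (tail H e)" "Inl w \<notin> set (H.awalk_verts \<alpha> q)"
      and r: "H.awalk (head H f) r \<beta>" "Inl w \<notin> set (H.awalk_verts (head H f) r)"
      using H.apath_split_inner[OF p w(1-3)] by metis
    have "(Inl w, tail H e) \<in> arcs_ends H" "(Inl w, head H f) \<in> arcs_ends H"
      using H.in_arcs_imp_in_arcs_ends[OF e(1)] H.in_arcs_imp_in_arcs_ends[OF f(1)] e f
        arcs_ends_symmetric[OF H_symmetric] by metis+
    then obtain B C where B: "tail H e = Inr B" "B \<in> blocks G" "w \<in> verts B"
      and C: "head H f = Inr C" "C \<in> blocks G" "w \<in> verts C"
      using H_arc_InlE by metis
    obtain x where x: "x \<in> verts B" "x \<noteq> w" "(u, x) \<in> (avoiding G w)\<^sup>*"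
      using avoiding_H_imp_avoiding_G[OF H.awalk_imp_avoiding[OF q] node(1)] neq B by auto
    have "(\<beta>, head H f) \<in> (avoiding H (Inl w))\<^sup>*"
      using H.awalk_imp_avoiding[OF r] by (rule avoiding_rtrancl_sym[OF H_symmetric])
    then obtain y where y: "y \<in> verts C" "y \<noteq> w" "(v, y) \<in> (avoiding G w)\<^sup>*"
      using avoiding_H_imp_avoiding_G[OF _ node(2)] neq C by fastforce
    have "(u, v) \<notin> (avoiding G w)\<^sup>*"
    proof
      assume "(u, v) \<in> (avoiding G w)\<^sup>*"
      then have "(x, y) \<in> (avoiding G w)\<^sup>*"
        using x(3) y(3) avoiding_rtrancl_sym[OF sym_arcs] by (meson rtrancl_trans)
      then show False using blocks_separated[of B w x C y] B C x y ef by auto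
    qed
    then show ?thesis using neq by (simp add: separators_def)
  qed
  moreover have "Inl w \<in> set (H.awalk_verts \<alpha> p) \<and> Inl w \<noteq> \<alpha> \<and> Inl w \<noteq> \<beta> \<and> w \<in> cut_verts G"
    if w: "w \<in> separators u v" for w
  proof -
    have neq: "w \<noteq> u" "w \<noteq> v" and nconn: "(u, v) \<notin> (avoiding G w)\<^sup>*"
      using w by (auto simp: separators_def)
    have "Inl w \<in> set (H.awalk_verts \<alpha> p)"
    proof (rule ccontr)
      assume "Inl w \<notin> set (H.awalk_verts \<alpha> p)"
      then obtain x where "x \<in> node_verts \<beta>" "x \<noteq> w" "(u, x) \<in> (avoiding G w)\<^sup>*"
        using avoiding_H_imp_avoiding_G[OF H.awalk_imp_avoiding[OF pw]] node neq by metis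
      then show False
        using node_verts_avoiding[OF \<beta>(1), of x v w] node neq nconn by (metis rtrancl_trans)
    qed
    moreover have "w \<in> cut_verts G"
    proof -
      \<comment> \<open>That a separator is a cut vertex is read off from the tree: its node lies on
        the path.\<close>
      have "Inl w \<in> pverts T" using pw calculation unfolding H.awalk_conv by auto
      then show ?thesis by (auto simp: block_cut_tree_def)
    qed
    ultimately show ?thesis using \<alpha>(2) \<beta>(2) neq by auto
  qed
  ultimately show ?thesis by (auto simp: tree_path_verts_eq[OF p])
qed

section \<open>Visibility\<close>

lemma ex_shortest_path:
  assumes "u \<in> verts G" "v \<in> verts G"
  obtains p where "shortest_path G u p v"
proof -
  obtain p where "apath u p v" using reachable_G[OF assms] reachable_apath by blast
  then show thesis
    using that ex_has_least_nat[of "\<lambda>p. apath u p v" p length] by (auto simp: shortest_path_def)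
qed

text \<open>If an inner vertex of a path does not separate its ends, its two neighbours on the path share
  a clique with it, so the path can be shortened.\<close>
lemma shortest_path_inner_verts:
  assumes "shortest_path G u p v"
  shows "set (inner_verts p) = separators u v"
proof -
  have p: "apath u p v" and least: "\<And>q. apath u q v \<Longrightarrow> length p \<le> length q"
    using assms by (auto simp: shortest_path_def)
  have "w \<in> separators u v" if w: "w \<in> set (awalk_verts u p)" "w \<noteq> u" "w \<noteq> v" for w
  proof -
    obtain q e f r where pq: "p = q @ e # f # r"
      and e: "e \<in> arcs G" "head G e = w" and f: "f \<in> arcs G" "tail G f = w"
      and ef: "tail G e \<noteq> head G f"
      and q: "awalk u q (tail G e)" "w \<notin> set (awalk_verts u q)"
      and r: "awalk (head G f) r v" "w \<notin> set (awalk_verts (head G f) r)"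
      using apath_split_inner[OF p w] by metis
    have "(u, v) \<notin> (avoiding G w)\<^sup>*"
    proof
      assume "(u, v) \<in> (avoiding G w)\<^sup>*"
      then have "(tail G e, head G f) \<in> (avoiding G w)\<^sup>*"
        using awalk_imp_avoiding[OF q] awalk_imp_avoiding[OF r]
          avoiding_rtrancl_sym[OF sym_arcs] by (meson rtrancl_trans)
      moreover have "(w, tail G e) \<in> arcs_ends G" "(w, head G f) \<in> arcs_ends G"
        using in_arcs_imp_in_arcs_ends[OF e(1)] in_arcs_imp_in_arcs_ends[OF f(1)] e f adj_sym
        by metis+
      ultimately obtain B where "B \<in> blocks G" "tail G e \<in> verts B" "head G f \<in> verts B"
        using ex_block_neighbours by metis
      then obtain g where "g \<in> arcs G" "tail G g = tail G e" "head G g = head G f"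
        using block_adj ef by (metis reachableE)
      then have "apath u (q @ g # r) v" using apath_shortcut p pq by blast
      then show False using least pq by fastforce
    qed
    then show ?thesis using w by (simp add: separators_def)
  qed
  \<comment> \<open>Conversely, every path between the ends, shortest or not, meets each
    separator.\<close>
  moreover have "w \<in> set (awalk_verts u p)" if "w \<in> separators u v" for w
    using awalk_imp_avoiding[OF awalkI_apath[OF p]] that by (auto simp: separators_def)
  ultimately show ?thesis by (auto simp: set_inner_verts[OF p] separators_def)
qed

text \<open>All shortest paths have the same inner vertices, so the choice of the path does not
  matter.\<close>

lemma k_visible_iff:
  assumes "u \<in> verts G" "v \<in> verts G"
  shows "k_visible G X k u v \<longleftrightarrow> card (separators u v \<inter> X) \<le> k"
proof -
  obtain p where "shortest_path G u p v" using ex_shortest_path[OF assms] .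
  then show ?thesis by (auto simp: k_visible_def shortest_path_inner_verts)
qed

section \<open>Translation between vertex sets of the graph and node sets of the tree\<close>

lemma own_verts_subset: "\<alpha> \<in> pverts T \<Longrightarrow> own_verts \<alpha> \<subseteq> verts G"
  using cut_verts_subset block_verts by (cases \<alpha>) (auto simp: block_cut_tree_def)

lemma ex_own_verts:
  assumes "u \<in> verts G" obtains \<alpha> where "\<alpha> \<in> pverts T" "u \<in> own_verts \<alpha>"
proof (cases "u \<in> cut_verts G")
  case True
  then show ?thesis using that[of "Inl u"] by (auto simp: block_cut_tree_def)
next
  case False
  obtain B where "B \<in> blocks G" "u \<in> verts B" using ex_block_vertex assms by blast
  then show ?thesis using that[of "Inr B"] False by (auto simp: block_cut_tree_def)
qed

text \<open>A vertex shared by two blocks is a cut vertex, which no block owns.\<close>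

lemma own_verts_inj:
  assumes "\<alpha> \<in> pverts T" "\<beta> \<in> pverts T" "u \<in> own_verts \<alpha>" "u \<in> own_verts \<beta>"
  shows "\<alpha> = \<beta>"
  using assms cut_vert_if_two_blocks by (cases \<alpha>; cases \<beta>) (auto simp: block_cut_tree_def)

lemma tree_to_verts_conv:
  "Z \<subseteq> pverts T \<Longrightarrow> tree_to_verts G Z = (\<Union>\<alpha>\<in>Z. own_verts \<alpha>)"
  unfolding tree_to_verts_def
  by (auto simp: block_cut_tree_def split: sum.splits)

lemma separators_cut:
  assumes "u \<in> verts G" "v \<in> verts G" shows "separators u v \<subseteq> cut_verts G"
proof -
  obtain \<alpha> \<beta> where "\<alpha> \<in> pverts T" "u \<in> own_verts \<alpha>" "\<beta> \<in> pverts T" "v \<in> own_verts \<beta>"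
    using ex_own_verts assms by metis
  then show ?thesis using tree_path_inner_cut_verts by blast
qed

text \<open>Only cut vertices are counted on either side, so it suffices that \<open>Z\<close> and
  \<open>X\<close> agree on these.\<close>

lemma admissible_count:
  assumes "\<alpha> \<in> pverts T" "u \<in> own_verts \<alpha>" "\<beta> \<in> pverts T" "v \<in> own_verts \<beta>"
    and X: "\<And>w. w \<in> cut_verts G \<Longrightarrow> Inl w \<in> Z \<longleftrightarrow> w \<in> X"
  shows "card ((tree_path_verts T \<alpha> \<beta> - {\<alpha>, \<beta>}) \<inter> (Z \<inter> Inl ` cut_verts G))
    = card (separators u v \<inter> X)"
proof -
  have uv: "u \<in> verts G" "v \<in> verts G" using assms own_verts_subset by blast+
  have "(tree_path_verts T \<alpha> \<beta> - {\<alpha>, \<beta>}) \<inter> (Z \<inter> Inl ` cut_verts G)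
      = Inl ` separators u v \<inter> Z"
    using tree_path_inner_cut_verts[OF assms(1-4)] by blast
  also have "\<dots> = Inl ` (separators u v \<inter> X)"
    using X separators_cut[OF uv] by auto
  finally show ?thesis by (simp add: card_image)
qed

lemma mutual_k_visible_tree_to_verts:
  assumes Z: "Z \<subseteq> pverts T" and adm: "k_admissible G k Z"
  shows "tree_to_verts G Z \<subseteq> verts G" "mutual_k_visible G k (tree_to_verts G Z)"
proof -
  show sub: "tree_to_verts G Z \<subseteq> verts G"
    using tree_to_verts_conv[OF Z] own_verts_subset Z by blast
  have cut: "Inl w \<in> Z \<longleftrightarrow> w \<in> tree_to_verts G Z" if "w \<in> cut_verts G" for w
    using that by (auto simp: tree_to_verts_def)
  show "mutual_k_visible G k (tree_to_verts G Z)"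
    unfolding mutual_k_visible_def
  proof (intro ballI impI)
    fix u v assume uv: "u \<in> tree_to_verts G Z" "v \<in> tree_to_verts G Z" "u \<noteq> v"
    then obtain \<alpha> \<beta> where \<alpha>: "\<alpha> \<in> Z" "u \<in> own_verts \<alpha>" and \<beta>: "\<beta> \<in> Z" "v \<in> own_verts \<beta>"
      using tree_to_verts_conv[OF Z] by auto
    have "card (separators u v \<inter> tree_to_verts G Z) \<le> k"
    \<comment> \<open>Admissibility is silent about a single node, but two vertices owned by one
      node lie in a common clique and have no separators.\<close>
    proof (cases "\<alpha> = \<beta>")
      case True
      then have "separators u v = {}"
        using node_verts_avoiding[of \<alpha> u v] \<alpha> \<beta> Z own_subset_node_verts
        by (fastforce simp: separators_def)
      then show ?thesis by simp
    next
      case False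
      then have "card ((tree_path_verts T \<alpha> \<beta> - {\<alpha>, \<beta>}) \<inter> (Z \<inter> Inl ` cut_verts G)) \<le> k"
        using adm \<alpha>(1) \<beta>(1) unfolding k_admissible_def by blast
      moreover have "\<alpha> \<in> pverts T" "\<beta> \<in> pverts T" using \<alpha> \<beta> Z by auto
      ultimately show ?thesis
        using admissible_count[OF _ \<alpha>(2) _ \<beta>(2) cut] by simp
    qed
    then show "k_visible G (tree_to_verts G Z) k u v"
      using k_visible_iff uv sub by blast
  qed
qed

text \<open>Only an inclusion holds: a block owning one vertex of \<open>X\<close> contributes all
  the vertices it owns. This adds no cut vertices, so the counts stay the same.\<close>

lemma ex_admissible_superset:
  assumes X: "X \<subseteq> verts G" and vis: "mutual_k_visible G k X"
  obtains Z where "Z \<subseteq> pverts T" "k_admissible G k Z" "X \<subseteq> tree_to_verts G Z"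
proof -
  define Z where "Z = {\<alpha> \<in> pverts T. own_verts \<alpha> \<inter> X \<noteq> {}}"
  have Z: "Z \<subseteq> pverts T" by (auto simp: Z_def)
  have cut: "Inl w \<in> Z \<longleftrightarrow> w \<in> X" if "w \<in> cut_verts G" for w
    using that by (auto simp: Z_def block_cut_tree_def)
  have "k_admissible G k Z"
    unfolding k_admissible_def
  proof (intro ballI impI)
    fix \<alpha> \<beta> assume ab: "\<alpha> \<in> Z" "\<beta> \<in> Z" "\<alpha> \<noteq> \<beta>"
    then obtain u v where u: "u \<in> own_verts \<alpha>" "u \<in> X" and v: "v \<in> own_verts \<beta>" "v \<in> X"
      by (auto simp: Z_def)
    \<comment> \<open>Visibility is assumed for distinct vertices only; distinct nodes own disjoint
      sets.\<close>
    have "u \<noteq> v" using own_verts_inj ab u v Z by blast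
    then have "card (separators u v \<inter> X) \<le> k"
      using vis u v X k_visible_iff[of u v X k] by (auto simp: mutual_k_visible_def)
    moreover have "\<alpha> \<in> pverts T" "\<beta> \<in> pverts T" using ab Z by auto
    ultimately show "card ((tree_path_verts T \<alpha> \<beta> - {\<alpha>, \<beta>}) \<inter> (Z \<inter> Inl ` cut_verts G)) \<le> k"
      using admissible_count[of \<alpha> u \<beta> v Z X, OF _ u(1) _ v(1) cut] by simp
  qed
  moreover have "X \<subseteq> tree_to_verts G Z"
  proof
    fix u assume u: "u \<in> X"
    then obtain \<alpha> where "\<alpha> \<in> pverts T" "u \<in> own_verts \<alpha>" using ex_own_verts X by blast
    then show "u \<in> tree_to_verts G Z"
      using u tree_to_verts_conv[OF Z] by (auto simp: Z_def)
  qed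
  ultimately show thesis using that Z by blast
qed

text \<open>Each value on the right is attained by a mutual \<open>k\<close>-visible set, and a
  largest such set is contained in some \<open>tree_to_verts G Z\<close> with \<open>Z\<close>
  admissible.\<close>

lemma mu_eq:
  "mu k G = Max {card (tree_to_verts G Z) | Z. Z \<subseteq> pverts T \<and> k_admissible G k Z}"
    (is "_ = Max ?R")
proof -
  let ?L = "{card X | X. X \<subseteq> verts G \<and> mutual_k_visible G k X}"
  have "?L \<subseteq> card ` Pow (verts G)" by auto
  then have fin: "finite ?L" by (rule finite_subset) simp
  have sub: "?R \<subseteq> ?L" using mutual_k_visible_tree_to_verts by blast
  \<comment> \<open>The empty node set keeps both value sets nonempty, so that both maxima are
    meaningful.\<close>
  have "k_admissible G k {}" by (simp add: k_admissible_def)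
  then have ne: "?R \<noteq> {}" by blast
  have "Max ?L \<in> ?L" using fin by (rule Max_in) (use ne sub in blast)
  then obtain X where X: "Max ?L = card X" "X \<subseteq> verts G" "mutual_k_visible G k X" by blast
  obtain Z where Z: "Z \<subseteq> pverts T" "k_admissible G k Z" "X \<subseteq> tree_to_verts G Z"
    using ex_admissible_superset X by blast
  have "finite (tree_to_verts G Z)"
    using mutual_k_visible_tree_to_verts(1)[OF Z(1,2)] finite_verts by (rule finite_subset)
  then have "card X \<le> card (tree_to_verts G Z)" using Z(3) by (rule card_mono)
  also have "\<dots> \<le> Max ?R"
  proof (rule Max_ge[OF finite_subset[OF sub fin]])
    show "card (tree_to_verts G Z) \<in> ?R" using Z(1,2) by auto
  qed
  finally have "Max ?L \<le> Max ?R" using X by simp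
  moreover have "Max ?R \<le> Max ?L" using sub ne fin by (rule Max_mono)
  ultimately show ?thesis by (simp add: mu_def)
qed

end

theorem theorem5p4:
  fixes G :: "('a, 'b) pre_digraph" and k :: nat
  assumes "graph G" and "connected G" and "block_graph G"
  shows "mu k G =
    Max {card (tree_to_verts G Z) | Z. Z \<subseteq> pverts (block_cut_tree G) \<and> k_admissible G k Z}"
proof -
  interpret connected_block_graph G
    using assms by (simp add: connected_block_graph_def connected_block_graph_axioms_def)
  show ?thesis by (rule mu_eq)
qed

end
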